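(* An idempotent groupoid $(A,\cdot)$ is a meld if and only if it satisfies the absorption identity $$x((yx)z) \approx x.$$
   Context: A groupoid is a set with one binary operation, written by juxtaposition; it is idempotent if $xx \approx x$. An idempotent groupoid is called a meld if it satisfies the identity $(xy)(zx) \approx xy$. *)

theory Defs
  imports Main
begin

locale groupoid =
  fixes A :: "'a set" and mult :: "'a \<Rightarrow> 'a \<Rightarrow> 'a" (infixl "\<cdot>" 70)
  assumes closed: "x \<in> A \<Longrightarrow> y \<in> A \<Longrightarrow> x \<cdot> y \<in> A"

locale idempotent_groupoid = groupoid +
  assumes idem: "x \<in> A \<Longrightarrow> x \<cdot> x = x"

locale meld = idempotent_groupoid +
  assumes meld_law: "x \<in> A \<Longrightarrow> y \<in> A \<Longrightarrow> z \<in> A \<Longrightarrow> (x \<cdot> y) \<cdot> (z \<cdot> x) = x \<cdot> y"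

end

theory Submission
  imports Defs
begin

text \<open>Write a ~ b for ab = a. With idempotence, either law yields a(ba) = a, that is a ~ ba;
  hence ~ is symmetric, since ab = a gives b = b(ab) = ba. The meld law says xy ~ zx and absorption
  says x ~ (yx)z, so each follows from the other by rewriting x as x(yx) or x(zx) and using this
  symmetry.\<close>

lemma (in meld) absorption:
  assumes "x \<in> A" "y \<in> A" "z \<in> A"
  shows "x \<cdot> ((y \<cdot> x) \<cdot> z) = x"
proof -
  have right_absorb: "a \<cdot> (b \<cdot> a) = a" if "a \<in> A" "b \<in> A" for a b
    using meld_law[of a a b] idem that by simp
  define u where "u = y \<cdot> x"
  have u: "u \<in> A" and uz: "u \<cdot> z \<in> A"
    using assms closed by (simp_all add: u_def)
  have "x \<cdot> u = x"
    using right_absorb assms by (simp add: u_def)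
  \<comment> \<open>Reading the factor \<open>x\<close> as \<open>x \<cdot> u\<close> gives it the
    shape of the second factor in the meld law.\<close>
  then have "(u \<cdot> z) \<cdot> x = u \<cdot> z"
    using meld_law[of u z x] u assms by simp
  then show ?thesis
    using right_absorb[of x "u \<cdot> z"] uz assms by (simp add: u_def)
qed

lemma (in idempotent_groupoid) meldI_absorption:
  assumes absorption: "\<And>x y z. x \<in> A \<Longrightarrow> y \<in> A \<Longrightarrow> z \<in> A \<Longrightarrow> x \<cdot> ((y \<cdot> x) \<cdot> z) = x"
  shows "meld A (\<cdot>)"
proof unfold_locales
  fix x y z
  assume xyz: "x \<in> A" "y \<in> A" "z \<in> A"
  define p q where "p = x \<cdot> y" and "q = z \<cdot> x"
  have pq: "p \<in> A" "q \<in> A"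
    using xyz closed by (simp_all add: p_def q_def)
  have "x \<cdot> q = x"
    using absorption[of x z q] idem[of q] xyz pq by (simp add: q_def)
  \<comment> \<open>Since \<open>x \<cdot> q\<close> is \<open>x\<close>, the product
    \<open>(x \<cdot> q) \<cdot> y\<close> absorbed by \<open>q\<close> is just
    \<open>p\<close>.\<close>
  then have "q \<cdot> p = q"
    using absorption[of q x y] xyz pq by (simp add: p_def)
  \<comment> \<open>Symmetry of ~: the absorbed term \<open>(q \<cdot> p) \<cdot> q\<close>
    collapses to \<open>q\<close>.\<close>
  then have "p \<cdot> q = p"
    using absorption[of p q q] idem[of q] pq by simp
  then show "(x \<cdot> y) \<cdot> (z \<cdot> x) = x \<cdot> y"
    by (simp add: p_def q_def)
qed

theorem proposition25:
  fixes A :: "'a set" and mult :: "'a \<Rightarrow> 'a \<Rightarrow> 'a" (infixl "\<cdot>" 70)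
  assumes "idempotent_groupoid A mult"
  shows "meld A mult \<longleftrightarrow> (\<forall>x\<in>A. \<forall>y\<in>A. \<forall>z\<in>A. x \<cdot> ((y \<cdot> x) \<cdot> z) = x)"
  using meld.absorption[of A mult] idempotent_groupoid.meldI_absorption[OF assms]
  by blast

end
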